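(* Let $Y$ be a Young diagram whose rows have exactly three distinct lengths. If $Y$ is wide, then $Y$ is Latin.
   Context: A Young diagram $Y$ is a finite left-aligned array of unit cells, given by a finite multiset of positive integers (its row lengths), arranged with the longest rows at the top and the shortest at the bottom. The conjugate of a Young diagram is obtained by interchanging rows and columns (so its row lengths are the column lengths of the original). A Young diagram $A$ dominates a Young diagram $B$ with the same number of cells if, for every $w\ge 1$, the sum of the $w$ largest row lengths of $A$ is at least the sum of the $w$ largest row lengths of $B$ (missing rows count as length $0$). $Y$ is wide if, for every subset of the rows of $Y$, the Young diagram formed by those rows dominates its conjugate. $Y$ is Latin if its cells can be filled with integers so that each row of length $l$ contains each of the numbers $1,\dots,l$ exactly once, and in each column all entries are distinct. *)

theory Defs
  imports "HOL-Library.Multiset"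
begin

text \<open>
  A Young diagram is represented by the multiset of its row lengths.
  Rows and columns are numbered from 0, the longest row being row 0.
\<close>

definition young_diagram :: "nat multiset \<Rightarrow> bool" where
  "young_diagram Y \<longleftrightarrow> (\<forall>l \<in># Y. 0 < l)"

definition row_list :: "nat multiset \<Rightarrow> nat list" where
  "row_list Y = rev (sorted_list_of_multiset Y)"

definition cells :: "nat multiset \<Rightarrow> (nat \<times> nat) set" where
  "cells Y = {(i, j). i < length (row_list Y) \<and> j < row_list Y ! i}"

text \<open>The index set \<open>snd ` cells Y\<close> consists of the nonempty columns.\<close>

definition conjugate :: "nat multiset \<Rightarrow> nat multiset" where
  "conjugate Y = image_mset (\<lambda>j. card {i. (i, j) \<in> cells Y}) (mset_set (snd ` cells Y))"

text \<open>
  \<open>take w\<close> returns the whole list if \<open>w\<close> exceeds its length, so missing rows count as 0.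
\<close>

definition dominates :: "nat multiset \<Rightarrow> nat multiset \<Rightarrow> bool" where
  "dominates A B \<longleftrightarrow> sum_mset A = sum_mset B \<and>
     (\<forall>w \<ge> 1. sum_list (take w (row_list A)) \<ge> sum_list (take w (row_list B)))"

text \<open>
  Rows of equal length are interchangeable here, so subsets of the rows are
  submultisets of the row lengths.
\<close>

definition wide :: "nat multiset \<Rightarrow> bool" where
  "wide Y \<longleftrightarrow> (\<forall>R. R \<subseteq># Y \<longrightarrow> dominates R (conjugate R))"

definition latin :: "nat multiset \<Rightarrow> bool" where
  "latin Y \<longleftrightarrow> (\<exists>f :: nat \<Rightarrow> nat \<Rightarrow> int.
     (\<forall>i < length (row_list Y). \<forall>k \<in> {1..int (row_list Y ! i)}.
        \<exists>!j. (i, j) \<in> cells Y \<and> f i j = k) \<and>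
     (\<forall>j. inj_on (\<lambda>i. f i j) {i. (i, j) \<in> cells Y}))"

end

theory Submission
  imports Defs
begin

text \<open>
  Write \<open>a > b > c\<close> for the three row lengths and \<open>p\<close>, \<open>q\<close>, \<open>r\<close> for their multiplicities. Look at a
  filling one pair (column, symbol) at a time: such a pair is used at most once, and recording the
  length of the row that uses it turns the rows of length \<open>l\<close> into a bipartite graph between \<open>l\<close>
  columns and \<open>l\<close> symbols, regular of degree the number of those rows. Conversely, edge-disjoint
  regular graphs of this kind split into perfect matchings, which are the rows of a Latin filling
  (\<open>latin_if_regular_packing\<close>).

  Columns and symbols are both cut into three groups \<open>[0,c)\<close>, \<open>[c,b)\<close>, \<open>[b,a)\<close>. It is enough to say how
  many edges of each graph run between each column group and each symbol group: any such numbers with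
  the right margins that together do not exceed the sizes of the blocks come from edge-disjoint regular
  graphs, because a table whose margins are all divisible by \<open>s\<close> is a sum of \<open>s\<close> tables with equal
  margins (\<open>margin_split\<close>), so that groups can be broken up into single columns and single symbols
  (\<open>partial_outline_disentangle\<close>). The divisibility statement follows from the integral
  transportation theorem (\<open>transportation\<close>).

  So only \<open>3 \<times> 3\<close> tables have to be found. Rows of length \<open>c\<close> leave no choice. The table of the rows
  of length \<open>b\<close> lives on two groups and has equal row and column margins, so it is determined by its
  off-diagonal entry \<open>z\<close>. The rows of length \<open>a\<close> then need a table below the residual capacities,
  and the cut conditions of the transportation theorem decide whether there is one. Each of these
  conditions contains \<open>z\<close> with coefficient \<open>-1\<close>, \<open>0\<close> or \<open>1\<close>; those that bound \<open>z\<close> from above are weak,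
  and the best choice is the largest possible \<open>z\<close>, the minimum of \<open>q * c\<close>, \<open>q * (b - c)\<close> and
  \<open>c * (b - c)\<close>.

  Wideness enters through one inequality. In any filling, a row of length \<open>l\<close> has at least \<open>m + n - l\<close>
  cells that lie in \<open>m\<close> given columns and contain one of \<open>n\<close> given symbols, where \<open>m\<close>, \<open>n \<le> l\<close>. All
  these cells compete for the same \<open>m * n\<close> pairs, and wideness ensures that there are never too many
  of them (\<open>wide_forced\<close>); this is a consequence of dominance for the subdiagram of the rows with a
  positive contribution. With the above \<open>z\<close>, every cut condition (\<open>residual_cut\<close>) follows from such
  box inequalities.
\<close>

section \<open>Integral transportation\<close>

text \<open>
  The capacity of a cut in the network with supplies at the rows and demands \<open>\<beta>\<close> at the columns:
  what the rows in \<open>U\<close> can get rid of if the columns in \<open>W\<close> take their full demand and the others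
  are limited only by the edge capacities \<open>u\<close>.
\<close>

definition cut_bound :: "('r \<Rightarrow> 'c \<Rightarrow> nat) \<Rightarrow> ('c \<Rightarrow> nat) \<Rightarrow> 'c set \<Rightarrow> 'r set \<Rightarrow> 'c set \<Rightarrow> nat" where
  "cut_bound u \<beta> C U W = sum \<beta> W + (\<Sum>r\<in>U. \<Sum>v\<in>C - W. u r v)"

lemma cut_bound_submodular:
  assumes fin: "finite R" "finite C" and sub: "U \<subseteq> R" "U' \<subseteq> R" "W \<subseteq> C" "W' \<subseteq> C"
  shows "cut_bound u \<beta> C (U \<union> U') (W \<union> W') + cut_bound u \<beta> C (U \<inter> U') (W \<inter> W')
    \<le> cut_bound u \<beta> C U W + cut_bound u \<beta> C U' W'"
proof -
  have fins: "finite U" "finite U'" "finite W" "finite W'"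
    using fin sub by (auto intro: finite_subset)
  have expand: "(\<Sum>r\<in>X. \<Sum>v\<in>C - Z. u r v) = (\<Sum>r\<in>R. \<Sum>v\<in>C. if r \<in> X \<and> v \<notin> Z then u r v else 0)"
    if "X \<subseteq> R" for X Z
  proof -
    have "(\<Sum>r\<in>R. \<Sum>v\<in>C. if r \<in> X \<and> v \<notin> Z then u r v else 0)
        = (\<Sum>r\<in>R. if r \<in> X then (\<Sum>v\<in>C. if v \<notin> Z then u r v else 0) else 0)"
      by (intro sum.cong refl) auto
    also have "\<dots> = (\<Sum>r\<in>X. \<Sum>v\<in>C. if v \<notin> Z then u r v else 0)"
      using that fin by (simp add: sum.inter_restrict[symmetric] Int_absorb1)
    also have "\<dots> = (\<Sum>r\<in>X. \<Sum>v\<in>C - Z. u r v)"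
      using fin by (simp add: sum.inter_filter[symmetric] set_diff_eq)
    finally show ?thesis ..
  qed
  have "(\<Sum>r\<in>U \<union> U'. \<Sum>v\<in>C - (W \<union> W'). u r v) + (\<Sum>r\<in>U \<inter> U'. \<Sum>v\<in>C - (W \<inter> W'). u r v)
    \<le> (\<Sum>r\<in>U. \<Sum>v\<in>C - W. u r v) + (\<Sum>r\<in>U'. \<Sum>v\<in>C - W'. u r v)"
    using sub by (simp add: expand Int_absorb1 le_infI1 sum.distrib[symmetric] flip: Un_subset_iff)
      (auto intro!: sum_mono)
  moreover have "sum \<beta> (W \<union> W') + sum \<beta> (W \<inter> W') = sum \<beta> W + sum \<beta> W'"
    using fins by (rule_tac sum.union_inter)
  ultimately show ?thesis by (simp add: cut_bound_def)
qed

text \<open>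
  Units are shipped one at a time. Fix a row \<open>r\<close> with positive supply. Shipping a unit from \<open>r\<close> to \<open>v\<close>
  destroys the cut condition only if some tight pair \<open>(U, W)\<close> has \<open>r \<notin> U\<close> and \<open>v \<in> W\<close>. By
  submodularity such tight pairs are closed under union, so if every usable \<open>v\<close> were blocked, a
  maximal tight pair would have all usable columns in \<open>W\<close>, and adding \<open>r\<close> to \<open>U\<close> would violate the
  cut condition.
\<close>

theorem transportation:
  fixes u :: "'r \<Rightarrow> 'c \<Rightarrow> nat"
  assumes fin: "finite R" "finite C"
    and "sum \<alpha> R = sum \<beta> C"
    and "\<And>U W. U \<subseteq> R \<Longrightarrow> W \<subseteq> C \<Longrightarrow> sum \<alpha> U \<le> cut_bound u \<beta> C U W"
  shows "\<exists>y. (\<forall>r\<in>R. \<forall>v\<in>C. y r v \<le> u r v) \<and> (\<forall>r\<in>R. (\<Sum>v\<in>C. y r v) = \<alpha> r)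
    \<and> (\<forall>v\<in>C. (\<Sum>r\<in>R. y r v) = \<beta> v)"
  using assms(3,4)
proof (induction "sum \<alpha> R" arbitrary: \<alpha> \<beta> u)
  case 0
  then have "\<forall>r\<in>R. \<alpha> r = 0" "\<forall>v\<in>C. \<beta> v = 0" using fin by auto
  then show ?case by (intro exI[of _ "\<lambda>_ _. 0"]) auto
next
  case (Suc n)
  then obtain r where r: "r \<in> R" "\<alpha> r > 0"
    by (metis neq0_conv sum.neutral nat.distinct(1))
  define tight where "tight U W \<longleftrightarrow> U \<subseteq> R \<and> W \<subseteq> C \<and> r \<notin> U \<and> cut_bound u \<beta> C U W = sum \<alpha> U" for U W
  have "tight {} {}" by (simp add: tight_def cut_bound_def)
  moreover have "\<forall>U W. tight U W \<longrightarrow> card W < Suc (card C)"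
    using fin by (auto simp: tight_def less_Suc_eq_le intro: card_mono)
  ultimately obtain U W where UW: "tight U W" and max: "\<And>U' W'. tight U' W' \<Longrightarrow> card W' \<le> card W"
    using ex_has_greatest_nat[of "\<lambda>(U, W). tight U W" "({}, {})" "\<lambda>(U, W). card W" "Suc (card C)"] by auto
  have UWs: "U \<subseteq> R" "W \<subseteq> C" "r \<notin> U" and UWe: "cut_bound u \<beta> C U W = sum \<alpha> U"
    using UW by (auto simp: tight_def)
  have finUW: "finite U" "finite W" using UWs fin finite_subset by auto
  \<comment> \<open>Otherwise \<open>insert r U\<close> has the same cut bound as \<open>U\<close> but a larger supply.\<close>
  obtain v where v: "v \<in> C" "v \<notin> W" "u r v > 0"
  proof (rule ccontr)
    assume "\<not> thesis"
    then have "\<forall>v\<in>C - W. u r v = 0" using that by auto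
    then have "cut_bound u \<beta> C (insert r U) W = cut_bound u \<beta> C U W"
      using UWs finUW by (simp add: cut_bound_def)
    moreover have "sum \<alpha> (insert r U) \<le> cut_bound u \<beta> C (insert r U) W"
      using Suc.prems(2) UWs r by simp
    ultimately show False using UWe UWs finUW r by simp
  qed
  have loose: "sum \<alpha> U' < cut_bound u \<beta> C U' W'"
    if s: "U' \<subseteq> R" "W' \<subseteq> C" "r \<notin> U'" "v \<in> W'" for U' W'
  proof (rule ccontr)
    assume "\<not> ?thesis"
    then have "cut_bound u \<beta> C U' W' = sum \<alpha> U'"
      using Suc.prems(2)[of U' W'] s by simp
    moreover have "finite U'" using s fin finite_subset by auto
    moreover have "sum \<alpha> (U \<union> U') \<le> cut_bound u \<beta> C (U \<union> U') (W \<union> W')"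
      "sum \<alpha> (U \<inter> U') \<le> cut_bound u \<beta> C (U \<inter> U') (W \<inter> W')"
      using UWs s by (auto intro!: Suc.prems(2))
    moreover have "sum \<alpha> (U \<union> U') + sum \<alpha> (U \<inter> U') = sum \<alpha> U + sum \<alpha> U'"
      using finUW \<open>finite U'\<close> by (rule_tac sum.union_inter)
    ultimately have "tight (U \<union> U') (W \<union> W')"
      using cut_bound_submodular[OF fin UWs(1) s(1) UWs(2) s(2), of u \<beta>] UWe UWs s
      by (auto simp: tight_def)
    then have "card (W \<union> W') \<le> card W" by (rule max)
    moreover have "card W < card (W \<union> W')"
      using s v fin UWs finite_subset by (intro psubset_card_mono) auto
    ultimately show False by simp
  qed
  define \<alpha>' where "\<alpha>' = \<alpha>(r := \<alpha> r - 1)"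
  define \<beta>' where "\<beta>' = \<beta>(v := \<beta> v - 1)"
  define u' where "u' = u(r := (u r)(v := u r v - 1))"
  \<comment> \<open>The pair \<open>({}, {v})\<close> is not tight either, so \<open>v\<close> still has demand.\<close>
  have bv: "\<beta> v > 0"
    using loose[of "{}" "{v}"] v by (simp add: cut_bound_def)
  have sa: "sum \<alpha>' X + (if r \<in> X then 1 else 0) = sum \<alpha> X" if "finite X" for X
  proof -
    have "sum \<alpha>' X + (\<Sum>i\<in>X. if i = r then 1 else 0) = sum \<alpha> X"
      unfolding sum.distrib[symmetric] \<alpha>'_def using r by (intro sum.cong) auto
    then show ?thesis using that by (auto simp: sum.delta)
  qed
  have sb: "sum \<beta>' X + (if v \<in> X then 1 else 0) = sum \<beta> X" if "finite X" for X
  proof -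
    have "sum \<beta>' X + (\<Sum>i\<in>X. if i = v then 1 else 0) = sum \<beta> X"
      unfolding sum.distrib[symmetric] \<beta>'_def using bv by (intro sum.cong) auto
    then show ?thesis using that by (auto simp: sum.delta)
  qed
  have su: "(\<Sum>i\<in>X. \<Sum>j\<in>Z. u' i j) + (if r \<in> X \<and> v \<in> Z then 1 else 0) = (\<Sum>i\<in>X. \<Sum>j\<in>Z. u i j)"
    if "finite X" "finite Z" for X Z
  proof -
    have "(\<Sum>i\<in>X. \<Sum>j\<in>Z. u' i j) + (\<Sum>i\<in>X. \<Sum>j\<in>Z. if j = v then if i = r then 1 else 0 else 0)
        = (\<Sum>i\<in>X. \<Sum>j\<in>Z. u i j)"
      unfolding sum.distrib[symmetric] u'_def using v by (intro sum.cong) auto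
    then show ?thesis using that by (cases "v \<in> Z") (auto simp: sum.delta)
  qed
  have "n = sum \<alpha>' R" using sa[of R] fin r Suc.hyps(2) by simp
  moreover have "sum \<alpha>' R = sum \<beta>' C"
    using sa[of R] sb[of C] fin r v Suc.prems(1) by simp
  moreover have "sum \<alpha>' X \<le> cut_bound u' \<beta>' C X Z" if XZ: "X \<subseteq> R" "Z \<subseteq> C" for X Z
  proof -
    have f: "finite X" "finite Z" "finite (C - Z)" using XZ fin finite_subset by auto
    show ?thesis
      using sa[OF f(1)] sb[OF f(2)] su[OF f(1,3)] loose[OF XZ] Suc.prems(2)[OF XZ] v(1)
      unfolding cut_bound_def by (auto split: if_splits)
  qed
  ultimately obtain y where y: "\<forall>i\<in>R. \<forall>j\<in>C. y i j \<le> u' i j"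
      "\<forall>i\<in>R. (\<Sum>j\<in>C. y i j) = \<alpha>' i" "\<forall>j\<in>C. (\<Sum>i\<in>R. y i j) = \<beta>' j"
    using Suc.hyps(1)[of \<alpha>' \<beta>' u'] by blast
  define y' where "y' i j = y i j + (if i = r \<and> j = v then 1 else 0)" for i j
  have "\<forall>i\<in>R. \<forall>j\<in>C. y' i j \<le> u i j"
  proof (intro ballI)
    fix i j assume "i \<in> R" "j \<in> C"
    then have "y i j \<le> u' i j" using y(1) by blast
    then show "y' i j \<le> u i j" using v(3) by (auto simp: y'_def u'_def split: if_splits)
  qed
  moreover have "(\<Sum>j\<in>C. y' i j) = \<alpha> i" if "i \<in> R" for i
    using y(2) that r v(1) fin by (cases "i = r") (auto simp: y'_def sum.distrib \<alpha>'_def)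
  moreover have "(\<Sum>i\<in>R. y' i j) = \<beta> j" if "j \<in> C" for j
    using y(3) that r(1) bv fin by (cases "j = v") (auto simp: y'_def sum.distrib \<beta>'_def)
  ultimately show ?case by blast
qed

text \<open>
  The fractional solution \<open>x / card I\<close> satisfies every cut condition, so by integrality there is an
  integral one, which can be split off.
\<close>

lemma margin_split:
  fixes x :: "'r \<Rightarrow> 'c \<Rightarrow> nat"
  assumes fin: "finite R" "finite C" and "finite I"
    and "\<And>r. r \<in> R \<Longrightarrow> (\<Sum>v\<in>C. x r v) = card I * \<alpha> r"
    and "\<And>v. v \<in> C \<Longrightarrow> (\<Sum>r\<in>R. x r v) = card I * \<beta> v"
  shows "\<exists>y. (\<forall>i\<in>I. \<forall>r\<in>R. (\<Sum>v\<in>C. y i r v) = \<alpha> r) \<and>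
     (\<forall>i\<in>I. \<forall>v\<in>C. (\<Sum>r\<in>R. y i r v) = \<beta> v) \<and>
     (\<forall>r\<in>R. \<forall>v\<in>C. (\<Sum>i\<in>I. y i r v) = x r v)"
  using assms(3-)
proof (induction I arbitrary: x rule: finite_induct)
  case empty
  then show ?case using fin by auto
next
  case (insert i I)
  have rs: "(\<Sum>v\<in>C. x r v) = Suc (card I) * \<alpha> r" if "r \<in> R" for r
    using insert that by simp
  have cs: "(\<Sum>r\<in>R. x r v) = Suc (card I) * \<beta> v" if "v \<in> C" for v
    using insert that by simp
  have "Suc (card I) * sum \<alpha> R = (\<Sum>r\<in>R. \<Sum>v\<in>C. x r v)" by (simp only: sum_distrib_left rs cong: sum.cong)
  also have "\<dots> = (\<Sum>v\<in>C. \<Sum>r\<in>R. x r v)" by (rule sum.swap)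
  also have "\<dots> = Suc (card I) * sum \<beta> C" by (simp only: sum_distrib_left cs cong: sum.cong)
  finally have tot: "sum \<alpha> R = sum \<beta> C" by (simp only: mult_cancel1) simp
  have "sum \<alpha> U \<le> cut_bound x \<beta> C U W" if UW: "U \<subseteq> R" "W \<subseteq> C" for U W
  proof -
    let ?X = "\<Sum>r\<in>U. \<Sum>v\<in>C - W. x r v"
    have "Suc (card I) * sum \<alpha> U = (\<Sum>r\<in>U. \<Sum>v\<in>C. x r v)"
      using UW by (simp only: sum_distrib_left) (intro sum.cong refl, use rs in auto)
    also have "\<dots> = ?X + (\<Sum>r\<in>U. \<Sum>v\<in>W. x r v)"
      by (simp only: sum.subset_diff[OF UW(2) fin(2)] sum.distrib)
    also have "(\<Sum>r\<in>U. \<Sum>v\<in>W. x r v) \<le> (\<Sum>r\<in>R. \<Sum>v\<in>W. x r v)"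
      using UW fin by (intro sum_mono2) auto
    also have "\<dots> = (\<Sum>v\<in>W. \<Sum>r\<in>R. x r v)" by (rule sum.swap)
    also have "\<dots> = Suc (card I) * sum \<beta> W"
      using UW by (simp only: sum_distrib_left) (intro sum.cong refl, use cs in auto)
    finally have "Suc (card I) * sum \<alpha> U \<le> ?X + Suc (card I) * sum \<beta> W" by simp
    also have "\<dots> \<le> Suc (card I) * (sum \<beta> W + ?X)" by (simp add: algebra_simps)
    finally show ?thesis unfolding cut_bound_def by (simp only: Suc_mult_le_cancel1)
  qed
  from transportation[OF fin tot this] obtain y where y: "\<forall>r\<in>R. \<forall>v\<in>C. y r v \<le> x r v"
    "\<forall>r\<in>R. (\<Sum>v\<in>C. y r v) = \<alpha> r" "\<forall>v\<in>C. (\<Sum>r\<in>R. y r v) = \<beta> v" by blast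
  have "(\<Sum>v\<in>C. x r v - y r v) = card I * \<alpha> r" if "r \<in> R" for r
    using that y rs by (simp add: sum_subtractf_nat)
  moreover have "(\<Sum>r\<in>R. x r v - y r v) = card I * \<beta> v" if "v \<in> C" for v
    using that y cs by (simp add: sum_subtractf_nat)
  ultimately obtain z where z: "\<forall>i\<in>I. \<forall>r\<in>R. (\<Sum>v\<in>C. z i r v) = \<alpha> r"
     "\<forall>i\<in>I. \<forall>v\<in>C. (\<Sum>r\<in>R. z i r v) = \<beta> v"
     "\<forall>r\<in>R. \<forall>v\<in>C. (\<Sum>i\<in>I. z i r v) = x r v - y r v"
    using insert.IH[of "\<lambda>r v. x r v - y r v"] by blast
  have ni: "j \<noteq> i" if "j \<in> I" for j using insert.hyps(2) that by auto
  show ?case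
    using insert.hyps y z ni by (intro exI[of _ "z(i := y)"]) (auto simp: sum.insert)
qed

section \<open>From block counts to edge-disjoint graphs\<close>

text \<open>
  The set \<open>J\<close> serves as the set of columns and as the set of symbols, both grouped by \<open>g\<close>, and
  \<open>x t u v\<close> prescribes the number of edges of type \<open>t\<close> between column group \<open>u\<close> and symbol group \<open>v\<close>.
  First each column group is split into its columns, with the symbols still merged; then each symbol
  group is split into its symbols. Both steps are instances of \<open>margin_split\<close>, applied to the matrix
  whose rows are the types, so the margins say that every column keeps its degree in each type and
  that each pair of column and symbol gets exactly one edge in the end.
\<close>

lemma outline_disentangle:
  fixes x :: "'t \<Rightarrow> 'g \<Rightarrow> 'g \<Rightarrow> nat" and g :: "'j \<Rightarrow> 'g" and J :: "'j set"
  defines "N \<equiv> \<lambda>u. card {j \<in> J. g j = u}"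
  assumes fin: "finite T" "finite G" "finite J" and g: "g ` J \<subseteq> G"
    and row: "\<And>t u. t \<in> T \<Longrightarrow> u \<in> G \<Longrightarrow> (\<Sum>v\<in>G. x t u v) = N u * m t u"
    and col: "\<And>t v. t \<in> T \<Longrightarrow> v \<in> G \<Longrightarrow> (\<Sum>u\<in>G. x t u v) = N v * m t v"
    and cell: "\<And>u v. u \<in> G \<Longrightarrow> v \<in> G \<Longrightarrow> (\<Sum>t\<in>T. x t u v) = N u * N v"
  shows "\<exists>w :: 'j \<Rightarrow> 'j \<Rightarrow> 't \<Rightarrow> nat. (\<forall>j\<in>J. \<forall>k\<in>J. (\<Sum>t\<in>T. w j k t) = 1) \<and>
     (\<forall>t\<in>T. \<forall>j\<in>J. (\<Sum>k\<in>J. w j k t) = m t (g j)) \<and>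
     (\<forall>t\<in>T. \<forall>k\<in>J. (\<Sum>j\<in>J. w j k t) = m t (g k))"
proof -
  have "\<forall>u\<in>G. \<exists>y. (\<forall>j\<in>{j \<in> J. g j = u}. \<forall>t\<in>T. (\<Sum>v\<in>G. y j t v) = m t u) \<and>
     (\<forall>j\<in>{j \<in> J. g j = u}. \<forall>v\<in>G. (\<Sum>t\<in>T. y j t v) = N v) \<and>
     (\<forall>t\<in>T. \<forall>v\<in>G. (\<Sum>j\<in>{j \<in> J. g j = u}. y j t v) = x t u v)"
     (is "\<forall>u\<in>G. \<exists>y. ?P u y")
    using fin row cell by (intro ballI margin_split) (auto simp: N_def)
  then obtain y where choice: "\<forall>u\<in>G. ?P u (y u)" using bchoice[of G ?P] by blast
  have y: "(\<Sum>v\<in>G. y u j t v) = m t u" if "u \<in> G" "j \<in> J" "g j = u" "t \<in> T" for u j t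
    using choice that by simp
  have y2: "(\<Sum>t\<in>T. y u j t v) = N v" if "u \<in> G" "j \<in> J" "g j = u" "v \<in> G" for u j v
    using choice that by simp
  have y3: "(\<Sum>j\<in>{j \<in> J. g j = u}. y u j t v) = x t u v" if "u \<in> G" "t \<in> T" "v \<in> G" for u t v
    using choice that by simp
  define Y where "Y j = y (g j) j" for j
  have gJ: "g j \<in> G" if "j \<in> J" for j using g that by auto
  have Y1: "(\<Sum>v\<in>G. Y j t v) = m t (g j)" if "j \<in> J" "t \<in> T" for j t
    using y[OF gJ] that by (simp add: Y_def)
  have Y2: "(\<Sum>t\<in>T. Y j t v) = N v" if "j \<in> J" "v \<in> G" for j v
    using y2[OF gJ] that by (simp add: Y_def)
  have Y3: "(\<Sum>j\<in>J. Y j t v) = N v * m t v" if "t \<in> T" "v \<in> G" for t v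
  proof -
    have "(\<Sum>j\<in>J. Y j t v) = (\<Sum>u\<in>G. \<Sum>j\<in>{j \<in> J. g j = u}. Y j t v)"
      using fin g by (rule_tac sum.group[symmetric])
    also have "\<dots> = (\<Sum>u\<in>G. x t u v)"
      using y3 that by (intro sum.cong refl) (simp add: Y_def)
    finally show ?thesis using col that by simp
  qed
  have "\<forall>v\<in>G. \<exists>z. (\<forall>k\<in>{k \<in> J. g k = v}. \<forall>t\<in>T. (\<Sum>j\<in>J. z k t j) = m t v) \<and>
     (\<forall>k\<in>{k \<in> J. g k = v}. \<forall>j\<in>J. (\<Sum>t\<in>T. z k t j) = 1) \<and>
     (\<forall>t\<in>T. \<forall>j\<in>J. (\<Sum>k\<in>{k \<in> J. g k = v}. z k t j) = Y j t v)"
     (is "\<forall>v\<in>G. \<exists>z. ?P v z")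
    using fin Y2 Y3 by (intro ballI margin_split) (auto simp: N_def)
  then obtain z where choice: "\<forall>v\<in>G. ?P v (z v)" using bchoice[of G ?P] by blast
  have z: "(\<Sum>j\<in>J. z v k t j) = m t v" if "v \<in> G" "k \<in> J" "g k = v" "t \<in> T" for v k t
    using choice that by simp
  have z2: "(\<Sum>t\<in>T. z v k t j) = 1" if "v \<in> G" "k \<in> J" "g k = v" "j \<in> J" for v k j
    using choice that by simp
  have z3: "(\<Sum>k\<in>{k \<in> J. g k = v}. z v k t j) = Y j t v" if "v \<in> G" "t \<in> T" "j \<in> J" for v t j
    using choice that by simp
  define w where "w j k t = z (g k) k t j" for j k t
  have "(\<Sum>t\<in>T. w j k t) = 1" if "j \<in> J" "k \<in> J" for j k
    using z2[OF gJ] that by (simp add: w_def)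
  moreover have "(\<Sum>j\<in>J. w j k t) = m t (g k)" if "k \<in> J" "t \<in> T" for k t
    using z[OF gJ] that by (simp add: w_def)
  moreover have "(\<Sum>k\<in>J. w j k t) = m t (g j)" if "j \<in> J" "t \<in> T" for j t
  proof -
    have "(\<Sum>k\<in>J. w j k t) = (\<Sum>v\<in>G. \<Sum>k\<in>{k \<in> J. g k = v}. w j k t)"
      using fin g by (rule_tac sum.group[symmetric])
    also have "\<dots> = (\<Sum>v\<in>G. Y j t v)"
      using z3 that by (intro sum.cong refl) (simp add: w_def)
    finally show ?thesis using Y1 that by simp
  qed
  ultimately show ?thesis by (intro exI[of _ w]) blast
qed

text \<open>
  The unused pairs form an additional type \<open>None\<close>, whose margins are the complements of the others.
\<close>

lemma partial_outline_disentangle: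
  fixes x :: "'t \<Rightarrow> 'g \<Rightarrow> 'g \<Rightarrow> nat" and g :: "'j \<Rightarrow> 'g" and J :: "'j set"
  defines "N \<equiv> \<lambda>u. card {j \<in> J. g j = u}"
  assumes fin: "finite T" "finite G" "finite J" and g: "g ` J \<subseteq> G"
    and row: "\<And>t u. t \<in> T \<Longrightarrow> u \<in> G \<Longrightarrow> (\<Sum>v\<in>G. x t u v) = N u * m t u"
    and col: "\<And>t v. t \<in> T \<Longrightarrow> v \<in> G \<Longrightarrow> (\<Sum>u\<in>G. x t u v) = N v * m t v"
    and cell: "\<And>u v. u \<in> G \<Longrightarrow> v \<in> G \<Longrightarrow> (\<Sum>t\<in>T. x t u v) \<le> N u * N v"
  shows "\<exists>w :: 'j \<Rightarrow> 'j \<Rightarrow> 't \<Rightarrow> nat. (\<forall>j\<in>J. \<forall>k\<in>J. (\<Sum>t\<in>T. w j k t) \<le> 1) \<and>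
     (\<forall>t\<in>T. \<forall>j\<in>J. (\<Sum>k\<in>J. w j k t) = m t (g j)) \<and>
     (\<forall>t\<in>T. \<forall>k\<in>J. (\<Sum>j\<in>J. w j k t) = m t (g k))"
proof -
  define T' where "T' = insert None (Some ` T)"
  define x' where "x' t u v = (case t of None \<Rightarrow> N u * N v - (\<Sum>t\<in>T. x t u v) | Some t \<Rightarrow> x t u v)"
    for t u v
  define m' where "m' t u = (case t of None \<Rightarrow> card J - (\<Sum>t\<in>T. m t u) | Some t \<Rightarrow> m t u)" for t u
  have sumT': "(\<Sum>t\<in>T'. h t) = h None + (\<Sum>t\<in>T. h (Some t))" for h :: "'t option \<Rightarrow> nat"
    using fin by (simp add: T'_def sum.reindex)
  have NG: "(\<Sum>u\<in>G. N u) = card J"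
    using sum.group[OF fin(3,2) g, of "\<lambda>_. 1::nat"] by (simp add: N_def)
  have row0: "(\<Sum>v\<in>G. N u * N v - (\<Sum>t\<in>T. x t u v)) = N u * (card J - (\<Sum>t\<in>T. m t u))"
    if "u \<in> G" for u
  proof -
    have "(\<Sum>v\<in>G. N u * N v - (\<Sum>t\<in>T. x t u v)) = (\<Sum>v\<in>G. N u * N v) - (\<Sum>v\<in>G. \<Sum>t\<in>T. x t u v)"
      using cell that by (intro sum_subtractf_nat) auto
    also have "(\<Sum>v\<in>G. \<Sum>t\<in>T. x t u v) = (\<Sum>t\<in>T. N u * m t u)"
      using row that by (subst sum.swap) (auto intro: sum.cong)
    finally show ?thesis by (simp add: sum_distrib_left[symmetric] NG diff_mult_distrib2)
  qed
  have col0: "(\<Sum>u\<in>G. N u * N v - (\<Sum>t\<in>T. x t u v)) = N v * (card J - (\<Sum>t\<in>T. m t v))"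
    if "v \<in> G" for v
  proof -
    have "(\<Sum>u\<in>G. N u * N v - (\<Sum>t\<in>T. x t u v)) = (\<Sum>u\<in>G. N u * N v) - (\<Sum>u\<in>G. \<Sum>t\<in>T. x t u v)"
      using cell that by (intro sum_subtractf_nat) auto
    also have "(\<Sum>u\<in>G. \<Sum>t\<in>T. x t u v) = (\<Sum>t\<in>T. N v * m t v)"
      using col that by (subst sum.swap) (auto intro: sum.cong)
    finally show ?thesis
      by (simp add: sum_distrib_left[symmetric] sum_distrib_right[symmetric] NG diff_mult_distrib2 mult.commute)
  qed
  have "finite T'" using fin by (simp add: T'_def)
  moreover have "(\<Sum>v\<in>G. x' t u v) = N u * m' t u" if "t \<in> T'" "u \<in> G" for t u
    using that row row0 by (auto simp: T'_def x'_def m'_def)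
  moreover have "(\<Sum>u\<in>G. x' t u v) = N v * m' t v" if "t \<in> T'" "v \<in> G" for t v
    using that col col0 by (auto simp: T'_def x'_def m'_def)
  moreover have "(\<Sum>t\<in>T'. x' t u v) = N u * N v" if "u \<in> G" "v \<in> G" for u v
    using that cell by (simp add: sumT' x'_def)
  ultimately obtain w where w: "\<forall>j\<in>J. \<forall>k\<in>J. (\<Sum>t\<in>T'. w j k t) = (1::nat)"
     "\<forall>t\<in>T'. \<forall>j\<in>J. (\<Sum>k\<in>J. w j k t) = m' t (g j)"
     "\<forall>t\<in>T'. \<forall>k\<in>J. (\<Sum>j\<in>J. w j k t) = m' t (g k)"
    using outline_disentangle[OF _ fin(2,3) g, of T' x' m'] by (auto simp: N_def)
  have "\<forall>j\<in>J. \<forall>k\<in>J. (\<Sum>t\<in>T. w j k (Some t)) \<le> 1"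
    using w(1) by (force simp: sumT')
  moreover have "\<forall>t\<in>T. \<forall>j\<in>J. (\<Sum>k\<in>J. w j k (Some t)) = m t (g j)"
    "\<forall>t\<in>T. \<forall>k\<in>J. (\<Sum>j\<in>J. w j k (Some t)) = m t (g k)"
    using w(2,3) by (simp_all add: m'_def T'_def)
  ultimately show ?thesis by (intro exI[of _ "\<lambda>j k t. w j k (Some t)"]) blast
qed

section \<open>Latin fillings as edge-disjoint regular graphs\<close>

lemma count_row_list: "card {i. i < length (row_list Y) \<and> row_list Y ! i = l} = count Y l"
proof -
  have "mset (row_list Y) = Y" by (simp add: row_list_def)
  then have "count Y l = length (filter ((=) l) (row_list Y))"
    using count_mset[of "row_list Y" l] by (simp add: count_list_eq_length_filter)
  also have "\<dots> = card {i. i < length (row_list Y) \<and> l = row_list Y ! i}"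
    by (rule length_filter_conv_card)
  also have "{i. i < length (row_list Y) \<and> l = row_list Y ! i}
      = {i. i < length (row_list Y) \<and> row_list Y ! i = l}" by auto
  finally show ?thesis by (rule sym)
qed

lemma set_row_list: "set (row_list Y) = set_mset Y"
  by (simp add: row_list_def)

text \<open>
  For a row length \<open>l\<close>, the function \<open>\<lambda>j k. w j k l\<close> is the adjacency matrix of the graph between
  columns \<open>j < l\<close> and symbols \<open>k < l\<close> (numbered from 0). A regular bipartite graph is a sum of
  permutation matrices, one for each row of length \<open>l\<close>; the symbol of a row in column \<open>j\<close> is read off
  from its matrix. Two rows cannot have the same symbol in the same column, because that pair would be
  used twice by the graphs.
\<close>

lemma latin_if_regular_packing:
  fixes w :: "nat \<Rightarrow> nat \<Rightarrow> nat \<Rightarrow> nat"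
  assumes row: "\<And>l j. l \<in># Y \<Longrightarrow> j < l \<Longrightarrow> (\<Sum>k<l. w j k l) = count Y l"
    and col: "\<And>l k. l \<in># Y \<Longrightarrow> k < l \<Longrightarrow> (\<Sum>j<l. w j k l) = count Y l"
    and disj: "\<And>l j k. l \<in># Y \<Longrightarrow> j < l \<Longrightarrow> k < l \<Longrightarrow> (\<Sum>l\<in>set_mset Y. w j k l) \<le> 1"
  shows "latin Y"
proof -
  define xs where "xs = row_list Y"
  define I where "I l = {i. i < length xs \<and> xs ! i = l}" for l
  have finI: "finite (I l)" for l by (simp add: I_def)
  have "\<forall>l\<in>set_mset Y. \<exists>y. (\<forall>i\<in>I l. \<forall>j\<in>{..<l}. (\<Sum>k\<in>{..<l}. y i j k) = 1) \<and>
     (\<forall>i\<in>I l. \<forall>k\<in>{..<l}. (\<Sum>j\<in>{..<l}. y i j k) = 1) \<and>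
     (\<forall>j\<in>{..<l}. \<forall>k\<in>{..<l}. (\<Sum>i\<in>I l. y i j k) = w j k l)"
     (is "\<forall>l\<in>_. \<exists>y. ?P l y")
  proof
    fix l assume l: "l \<in> set_mset Y"
    have c: "card (I l) = count Y l" by (simp add: I_def xs_def count_row_list)
    show "\<exists>y. (\<forall>i\<in>I l. \<forall>j\<in>{..<l}. (\<Sum>k\<in>{..<l}. y i j k) = 1) \<and>
     (\<forall>i\<in>I l. \<forall>k\<in>{..<l}. (\<Sum>j\<in>{..<l}. y i j k) = 1) \<and>
     (\<forall>j\<in>{..<l}. \<forall>k\<in>{..<l}. (\<Sum>i\<in>I l. y i j k) = w j k l)"
      using finI l row col by (intro margin_split) (auto simp: c)
  qed
  then obtain y where choice: "\<forall>l\<in>set_mset Y. ?P l (y l)" using bchoice[of "set_mset Y" ?P] by blast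
  have y: "(\<Sum>k<l. y l i j k) = 1" if "l \<in># Y" "i \<in> I l" "j < l" for l i j
    using choice that by simp
  have y2: "(\<Sum>j<l. y l i j k) = 1" if "l \<in># Y" "i \<in> I l" "k < l" for l i k
    using choice that by simp
  have y3: "(\<Sum>i\<in>I l. y l i j k) = w j k l" if "l \<in># Y" "j < l" "k < l" for l j k
    using choice that by simp
  define P where "P i j k \<longleftrightarrow> y (xs ! i) i j k > 0" for i j k
  have Y: "xs ! i \<in># Y" "i \<in> I (xs ! i)" if "i < length xs" for i
    using that nth_mem[OF that] by (simp_all add: xs_def set_row_list I_def)
  have one: "\<exists>!a. a < n \<and> h a > 0" if sum1: "(\<Sum>a<n. h a) = 1" for n and h :: "nat \<Rightarrow> nat"
  proof -
    have "\<exists>a\<in>{..<n}. h a = 1 \<and> (\<forall>b\<in>{..<n}. a \<noteq> b \<longrightarrow> h b = 0)"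
      by (rule sum_eq_1_iff[THEN iffD1, OF finite_lessThan sum1])
    then obtain a where a: "a < n" "h a = 1" and "\<forall>b<n. a \<noteq> b \<longrightarrow> h b = 0"
      by (auto simp only: lessThan_iff)
    then have "b = a" if "b < n \<and> h b > 0" for b using that by (metis less_numeral_extra(3))
    then show ?thesis using a by (intro ex1I[of _ a]) simp_all
  qed
  have P1: "\<exists>!k. k < xs ! i \<and> P i j k" if "i < length xs" "j < xs ! i" for i j
    using one[OF y[OF Y[OF that(1)] that(2)]] by (simp add: P_def)
  have P2: "\<exists>!j. j < xs ! i \<and> P i j k" if "i < length xs" "k < xs ! i" for i k
    using one[OF y2[OF Y[OF that(1)] that(2)]] by (simp add: P_def)
  have P3: "i = i'" if i: "i < length xs" "i' < length xs" and j: "j < xs ! i" "j < xs ! i'"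
    and k: "k < xs ! i" "k < xs ! i'" and P: "P i j k" "P i' j k" for i i' j k
  proof -
    have w1: "w j k (xs ! a) \<ge> (\<Sum>b\<in>A. y (xs ! a) b j k)"
      if "a < length xs" "j < xs ! a" "k < xs ! a" "A \<subseteq> I (xs ! a)" for a A
      using y3[OF Y(1) that(2,3)] that finI sum_mono2[OF finI that(4), of "\<lambda>b. y (xs ! a) b j k"] by simp
    have le: "(\<Sum>l\<in>L. w j k l) \<le> 1" if "L \<subseteq> set_mset Y" for L
      using disj[OF Y(1)[OF i(1)] j(1) k(1)] sum_mono2[OF _ that, of "\<lambda>l. w j k l"] by simp
    note Yi = Y[OF i(1)] and Yi' = Y[OF i(2)]
    note w2 = w1[OF i(1) j(1) k(1)] and w2' = w1[OF i(2) j(2) k(2)]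
    have l: "xs ! i = xs ! i'"
    proof (rule ccontr)
      assume ne: "xs ! i \<noteq> xs ! i'"
      have "w j k (xs ! i) + w j k (xs ! i') \<le> 1"
        using le[of "{xs ! i, xs ! i'}"] Yi(1) Yi'(1) ne by simp
      moreover have "w j k (xs ! i) \<ge> 1" "w j k (xs ! i') \<ge> 1"
        using w2[of "{i}"] w2'[of "{i'}"] Yi(2) Yi'(2) P by (simp_all add: P_def)
      ultimately show False by simp
    qed
    show ?thesis
    proof (rule ccontr)
      assume "i \<noteq> i'"
      then have "y (xs ! i) i j k + y (xs ! i) i' j k \<le> w j k (xs ! i)"
        using w2[of "{i, i'}"] Yi(2) Yi'(2) l by simp
      then show False
        using le[of "{xs ! i}"] Yi(1) P l by (simp add: P_def)
    qed
  qed
  define s where "s i j = (THE k. k < xs ! i \<and> P i j k)" for i j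
  have s: "s i j < xs ! i \<and> P i j (s i j)" if "i < length xs" "j < xs ! i" for i j
    unfolding s_def using theI'[OF P1[OF that]] .
  have s_eq: "s i j = k \<longleftrightarrow> P i j k" if "i < length xs" "j < xs ! i" "k < xs ! i" for i j k
  proof
    show "P i j k" if "s i j = k" using that s[OF \<open>i < length xs\<close> \<open>j < xs ! i\<close>] by simp
    show "s i j = k" if "P i j k"
      unfolding s_def using that \<open>k < xs ! i\<close>
      by (intro the1_equality P1 \<open>i < length xs\<close> \<open>j < xs ! i\<close>) simp
  qed
  have cells: "(i, j) \<in> cells Y \<longleftrightarrow> i < length xs \<and> j < xs ! i" for i j
    by (simp add: cells_def xs_def)
  show ?thesis
    unfolding latin_def xs_def[symmetric]
  proof (intro exI[of _ "\<lambda>i j. int (Suc (s i j))"] conjI allI impI ballI)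
    fix i k assume i: "i < length xs" and k: "k \<in> {1..int (xs ! i)}"
    then have k': "nat k - 1 < xs ! i" "k = int (Suc (nat k - 1))" by auto
    have "int (Suc (s i j)) = k \<longleftrightarrow> s i j = nat k - 1" for j
      using k'(2) by linarith
    then have "(i, j) \<in> cells Y \<and> int (Suc (s i j)) = k \<longleftrightarrow> j < xs ! i \<and> P i j (nat k - 1)" for j
      using s_eq[OF i _ k'(1), of j] i by (cases "j < xs ! i") (simp_all add: cells)
    then show "\<exists>!j. (i, j) \<in> cells Y \<and> int (Suc (s i j)) = k"
      using P2[OF i k'(1)] by simp
  next
    fix j show "inj_on (\<lambda>i. int (Suc (s i j))) {i. (i, j) \<in> cells Y}"
    proof (rule inj_onI)
      fix i i' assume "i \<in> {i. (i, j) \<in> cells Y}" "i' \<in> {i. (i, j) \<in> cells Y}"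
        and eq: "int (Suc (s i j)) = int (Suc (s i' j))"
      then have i: "i < length xs" "i' < length xs" "j < xs ! i" "j < xs ! i'" by (simp_all add: cells)
      have "s i' j = s i j" using eq by simp
      then show "i = i'" using P3[OF i] s[OF i(1,3)] s[OF i(2,4)] by auto
    qed
  qed
qed

section \<open>The box inequality for wide diagrams\<close>

lemma sum_submultiset_le_take:
  fixes xs :: "nat list"
  assumes "sorted_wrt (\<ge>) xs" "S \<subseteq># mset xs" "size S \<le> w"
  shows "sum_mset S \<le> sum_list (take w xs)"
  using assms
proof (induction xs arbitrary: S w)
  case (Cons x xs)
  show ?case
  proof (cases "S = {#}")
    case False
    then obtain w' where w: "w = Suc w'" using Cons.prems(3) by (cases w) simp_all
    obtain y S' where y: "S = add_mset y S'" "y \<le> x" "S' \<subseteq># mset xs"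
    proof (cases "x \<in># S")
      case True
      then obtain S' where "S = add_mset x S'" by (meson multi_member_split)
      then show thesis using that[of x S'] Cons.prems(2) by simp
    next
      case False
      from \<open>S \<noteq> {#}\<close> obtain y S' where yS: "S = add_mset y S'" by (meson multiset_cases)
      have sub: "S \<subseteq># mset xs"
        using Cons.prems(2) False by (simp flip: Diff_eq_empty_iff_mset)
      then have "y \<in> set xs" using mset_subset_eqD[OF sub, of y] yS by simp
      moreover have "S' \<subseteq># mset xs"
        using sub mset_subset_eq_insertD[of y S' "mset xs"] yS by (simp add: subset_mset_def)
      ultimately show thesis using that[OF yS] Cons.prems(1) by simp
    qed
    have "sum_mset S' \<le> sum_list (take w' xs)"
      using Cons.prems(1,3) y(1,3) w by (intro Cons.IH) simp_all
    then show ?thesis using y w by simp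
  qed simp
qed simp

text \<open>
  The left-hand side is the number of cells in the first \<open>w\<close> columns, hence at most the sum of the \<open>w\<close>
  largest rows of the conjugate, and by dominance at most the sum of the \<open>w\<close> largest rows of \<open>R\<close>. Each
  of these rows is at most \<open>h\<close> plus its excess over \<open>h\<close>.
\<close>

lemma dominates_conjugate_box:
  assumes "dominates R (conjugate R)"
  shows "(\<Sum>l\<in>#R. min l w) \<le> w * h + (\<Sum>l\<in>#R. l - h)"
proof (cases "w = 0")
  case False
  define xs where "xs = row_list R"
  have R: "mset xs = R" by (simp add: xs_def row_list_def)
  let ?col = "\<lambda>j. card {i. (i, j) \<in> cells R}"
  let ?J = "{..<w} \<inter> snd ` cells R"
  have cells: "cells R = (SIGMA i:{..<length xs}. {..<xs ! i})"
    by (auto simp: cells_def xs_def)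
  have fin: "finite (snd ` cells R)" unfolding cells by auto
  have "(\<Sum>l\<in>#R. min l w) = sum_list (map (\<lambda>l. min l w) xs)"
    by (metis R mset_map sum_mset_sum_list)
  also have "\<dots> = (\<Sum>i<length xs. min (xs ! i) w)"
    by (simp add: sum_list_sum_nth atLeast0LessThan)
  also have "\<dots> = (\<Sum>i<length xs. \<Sum>j<w. if j < xs ! i then 1 else 0)"
  proof (intro sum.cong refl)
    fix i
    have "{j\<in>{..<w}. j < xs ! i} = {..<min (xs ! i) w}" by auto
    then show "min (xs ! i) w = (\<Sum>j<w. if j < xs ! i then 1 else 0)"
      by (simp add: sum.inter_filter[symmetric])
  qed
  also have "\<dots> = (\<Sum>j<w. \<Sum>i<length xs. if j < xs ! i then 1 else 0)" by (rule sum.swap)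
  also have "\<dots> = (\<Sum>j<w. ?col j)"
    by (intro sum.cong refl) (simp add: sum.inter_filter[symmetric] cells)
  also have "\<dots> = sum ?col ?J"
  proof (intro sum.mono_neutral_right ballI)
    fix j assume "j \<in> {..<w} - ?J"
    then have "{i. (i, j) \<in> cells R} = {}" by force
    then show "?col j = 0" by simp
  qed auto
  also have "\<dots> = sum_mset (image_mset ?col (mset_set ?J))" by (simp add: sum_unfold_sum_mset)
  also have "\<dots> \<le> sum_list (take w (row_list (conjugate R)))"
  proof (rule sum_submultiset_le_take)
    show "sorted_wrt (\<ge>) (row_list (conjugate R))"
      by (simp add: row_list_def sorted_wrt_rev)
    show "image_mset ?col (mset_set ?J) \<subseteq># mset (row_list (conjugate R))"
      using fin by (simp add: row_list_def conjugate_def image_mset_subseteq_mono subset_imp_msubset_mset_set)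
    show "size (image_mset ?col (mset_set ?J)) \<le> w"
      using card_mono[of "{..<w}" ?J] by simp
  qed
  also have "\<dots> \<le> sum_list (take w xs)"
    using assms False by (simp add: dominates_def xs_def)
  also have "\<dots> \<le> sum_list (map (\<lambda>l. h + (l - h)) (take w xs))"
    by (rule sum_list_mono2) auto
  also have "\<dots> = length (take w xs) * h + sum_list (map (\<lambda>l. l - h) (take w xs))"
    by (simp add: sum_list_addf sum_list_triv)
  also have "\<dots> \<le> w * h + (\<Sum>l\<in>#R. l - h)"
  proof (rule add_mono)
    have "(\<Sum>l\<in>#R. l - h) = sum_list (map (\<lambda>l. l - h) (take w xs @ drop w xs))"
      by (metis R append_take_drop_id mset_map sum_mset_sum_list)
    then show "sum_list (map (\<lambda>l. l - h) (take w xs)) \<le> (\<Sum>l\<in>#R. l - h)"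
      by (simp only: map_append sum_list_append)
  qed simp
  finally show ?thesis .
qed simp

lemma sum_mset_eq_sum_count:
  fixes f :: "'a \<Rightarrow> int"
  assumes "finite S" "set_mset M \<subseteq> S"
  shows "(\<Sum>x\<in>#M. f x) = (\<Sum>x\<in>S. int (count M x) * f x)"
  using assms(2)
proof (induction M)
  case (add a M)
  have "(\<Sum>x\<in>S. int (count (add_mset a M) x) * f x)
      = (\<Sum>x\<in>S. int (count M x) * f x + (if x = a then f x else 0))"
    by (intro sum.cong) (auto simp: algebra_simps)
  then show ?case using add assms(1) by (simp add: sum.distrib)
qed simp

lemma sum_mset_le_sum_positive:
  fixes f :: "'a \<Rightarrow> int"
  shows "(\<Sum>x\<in>#M. f x) \<le> (\<Sum>x\<in>#filter_mset (\<lambda>x. f x > 0) M. f x)"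
  by (induction M) auto

text \<open>
  The least possible number of cells of a row of length \<open>l\<close> that lie in the first \<open>m\<close> columns and
  contain one of the symbols \<open>1, \<dots>, n\<close>.
\<close>

definition forced :: "int \<Rightarrow> int \<Rightarrow> int \<Rightarrow> int" where
  "forced l m n = max 0 (min l m + min l n - l)"

text \<open>
  Dominance is needed only for the subdiagram of those rows that are forced to meet the box: for them
  the maximum with 0 can be dropped.
\<close>

lemma wide_forced:
  fixes w h :: nat
  assumes "wide Y"
  shows "(\<Sum>l\<in>set_mset Y. int (count Y l) * forced (int l) (int w) (int h)) \<le> int w * int h"
proof -
  define e where "e l = forced (int l) (int w) (int h)" for l
  define R where "R = filter_mset (\<lambda>l. e l > 0) Y"
  have "dominates R (conjugate R)" using assms(1) by (simp add: wide_def R_def)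
  then have "int (\<Sum>l\<in>#R. min l w) \<le> int (w * h + (\<Sum>l\<in>#R. l - h))"
    by (intro zle_int[THEN iffD2] dominates_conjugate_box)
  then have R: "(\<Sum>l\<in>#R. int (min l w)) \<le> int w * int h + (\<Sum>l\<in>#R. int (l - h))"
    by (simp add: image_mset.compositionality comp_def)
  have "(\<Sum>l\<in>set_mset Y. int (count Y l) * e l) = (\<Sum>l\<in>#Y. e l)"
    by (rule sum_mset_eq_sum_count[symmetric]) auto
  also have "\<dots> \<le> (\<Sum>l\<in>#R. e l)"
    unfolding R_def by (rule sum_mset_le_sum_positive)
  also have "\<dots> \<le> (\<Sum>l\<in>#R. int (min l w) - int (l - h))"
  proof (rule sum_mset_mono)
    fix l assume "l \<in># R"
    then have "e l > 0" by (simp add: R_def)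
    then show "e l \<le> int (min l w) - int (l - h)" unfolding e_def forced_def by linarith
  qed
  also have "\<dots> = (\<Sum>l\<in>#R. int (min l w)) - (\<Sum>l\<in>#R. int (l - h))"
    by (induction R) auto
  also have "\<dots> \<le> int w * int h" using R by simp
  finally show ?thesis unfolding e_def .
qed

section \<open>Block counts for three row lengths\<close>

text \<open>
  The lengths are \<open>x\<close>, \<open>x + y\<close>, \<open>x + y + w\<close>, with multiplicities \<open>r\<close>, \<open>q\<close>, \<open>p\<close>, so that \<open>x\<close>, \<open>y\<close>, \<open>w\<close>
  are the sizes of the three groups of columns and of symbols.
\<close>

locale three_lengths =
  fixes p q r x y w :: int
  assumes nonneg: "0 \<le> p" "0 \<le> q" "0 \<le> r" and pos: "0 < x" "0 < y" "0 < w"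
    and box_forced: "\<And>m n. 0 \<le> m \<Longrightarrow> 0 \<le> n \<Longrightarrow>
      p * forced (x + y + w) m n + q * forced (x + y) m n + r * forced x m n \<le> m * n"
begin

text \<open>
  Replacing each maximum and minimum by one of its arguments gives the linear inequalities that are
  used below.
\<close>

lemma box:
  assumes mn: "0 \<le> m" "0 \<le> n"
    and a: "ea = 0 \<or> ea \<le> m \<and> ea \<le> n \<and> ea \<le> x + y + w \<and> ea \<le> m + n - (x + y + w)"
    and b: "eb = 0 \<or> eb \<le> m \<and> eb \<le> n \<and> eb \<le> x + y \<and> eb \<le> m + n - (x + y)"
    and c: "ec = 0 \<or> ec \<le> m \<and> ec \<le> n \<and> ec \<le> x \<and> ec \<le> m + n - x"
  shows "p * ea + q * eb + r * ec \<le> m * n"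
proof -
  have "ea \<le> forced (x + y + w) m n" "eb \<le> forced (x + y) m n" "ec \<le> forced x m n"
    using a b c unfolding forced_def by linarith+
  then have "p * ea + q * eb + r * ec
      \<le> p * forced (x + y + w) m n + q * forced (x + y) m n + r * forced x m n"
    using nonneg by (intro add_mono mult_left_mono)
  also have "\<dots> \<le> m * n" by (rule box_forced[OF mn])
  finally show ?thesis .
qed

text \<open>
  The number of cells that rows of length \<open>x + y\<close> place in columns of group 0 with symbols of group 1,
  which is also the number for group 1 and group 0. The margins \<open>q * x\<close>, \<open>q * y\<close> and the size
  \<open>x * y\<close> of the block bound it, and it is chosen as large as they allow.
\<close>

definition z :: int where "z = min (q * x) (min (q * y) (x * y))"

definition group_size :: "nat \<Rightarrow> int" where
  "group_size u = (if u = 0 then x else if u = 1 then y else w)"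

text \<open>
  The block counts of the rows of length \<open>x + y\<close>: the margins leave \<open>q * x - z\<close> and \<open>q * y - z\<close> for the
  diagonal.
\<close>

definition middle :: "nat \<Rightarrow> nat \<Rightarrow> int" where
  "middle u v = (if u = 0 \<and> v = 0 then q * x - z else if u = 1 \<and> v = 1 then q * y - z
     else if u < 2 \<and> v < 2 then z else 0)"

definition residual :: "nat \<Rightarrow> nat \<Rightarrow> int" where
  "residual u v = group_size u * group_size v - middle u v - (if u = 0 \<and> v = 0 then r * x else 0)"

lemma z_bounds: "0 \<le> z" "z \<le> q * x" "z \<le> q * y" "z \<le> x * y"
  using nonneg pos by (simp_all add: z_def)

lemma z_cases:
  obtains (qx) "z = q * x" "q * y \<le> y * y" | (qy) "z = q * y" | (xy) "z = x * y"
proof -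
  consider "z = x * y" | "z = q * x" "q * x \<le> y * x" | "z = q * y" "q * y \<le> x * y"
    unfolding z_def by (cases "q * x \<le> q * y"; cases "q * x \<le> x * y"; cases "q * y \<le> x * y")
      (simp_all add: min_def mult.commute)
  then show thesis using that pos by cases simp_all
qed

text \<open>
  In a box of one column and \<open>n\<close> symbols, every row of length at most \<open>n\<close> has exactly one cell.
\<close>

lemma counts: "p + q + r \<le> x + y + w" "q + r \<le> x + y" "r \<le> x"
  using box[of 1 "x + y + w" 1 1 1] box[of 1 "x + y" 0 1 1] box[of 1 x 0 0 1] pos by simp_all

lemma products: "0 \<le> p * x" "0 \<le> p * y" "0 \<le> p * w" "0 \<le> q * x"
    "0 \<le> y * y" "0 \<le> x * w" "0 \<le> y * w" "0 \<le> w * w"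
  using nonneg pos by auto

lemma count_products:
  "(p + q + r) * x \<le> (x + y + w) * x" "(p + q) * y \<le> (x + y + w) * y" "p * w \<le> (x + y + w) * w"
  "(q + r) * x \<le> (x + y) * x" "q * y \<le> (x + y) * y" "r * x \<le> x * x"
  using nonneg pos counts by (auto intro!: mult_right_mono)

text \<open>
  The entries of \<open>residual\<close> in the blocks of the first two groups, in expanded form.
\<close>

abbreviation "K00 \<equiv> x * x - (q * x - z) - r * x"
abbreviation "K01 \<equiv> x * y - z"
abbreviation "K11 \<equiv> y * y - (q * y - z)"

text \<open>
  The inequality \<open>cut_U_V\<close> is the cut condition for the column groups \<open>U\<close> and the symbol groups \<open>V\<close>:
  the longest rows have at least \<open>p * (s + t - (x + y + w))\<close> cells in these blocks, where \<open>s\<close> and \<open>t\<close>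
  are the total sizes of \<open>U\<close> and \<open>V\<close>, and these must fit into the residual capacity. If \<open>U\<close> or \<open>V\<close>
  contains both or none of the groups 0 and 1, then \<open>z\<close> cancels, and the
  box with \<open>s\<close> columns and \<open>t\<close> symbols gives the claim; if \<open>U\<close> contains all groups, it is a multiple of
  a bound on the number of rows.
\<close>

lemma cut_012_0: "p * x \<le> K00 + K01 + x * w"
  using count_products(1) by (simp add: algebra_simps)

lemma cut_012_1: "p * y \<le> K01 + K11 + y * w"
  using count_products(2) by (simp add: algebra_simps)

lemma cut_012_2: "p * w \<le> x * w + y * w + w * w"
  using count_products(3) by (simp add: algebra_simps)

lemma cut_01_0: "p * (x - w) \<le> K00 + K01"
proof -
  have "p * (x - w) + q * x + r * x \<le> (x + y) * x"
    using box[of "x + y" x "x - w" x x] pos by simp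
  then show ?thesis by (simp add: algebra_simps)
qed

lemma cut_01_1: "p * (y - w) \<le> K01 + K11"
proof -
  have "p * (y - w) + q * y \<le> (x + y) * y"
    using box[of "x + y" y "y - w" y 0] pos by simp
  then show ?thesis by (simp add: algebra_simps)
qed

lemma cut_01_01: "p * (x + y - w) \<le> K00 + K01 + K01 + K11"
proof -
  have "p * (x + y - w) + q * (x + y) + r * x \<le> (x + y) * (x + y)"
    using box[of "x + y" "x + y" "x + y - w" "x + y" x] pos by simp
  then show ?thesis by (simp add: algebra_simps)
qed

lemma cut_01_02: "p * x \<le> K00 + K01 + x * w + y * w"
proof -
  have "p * x + q * x + r * x \<le> (x + y) * (x + w)"
    using box[of "x + y" "x + w" x x x] pos by simp
  then show ?thesis by (simp add: algebra_simps)
qed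

lemma cut_01_12: "p * y \<le> K01 + K11 + x * w + y * w"
proof -
  have "p * y + q * y \<le> (x + y) * (y + w)"
    using box[of "x + y" "y + w" y y 0] pos by simp
  then show ?thesis by (simp add: algebra_simps)
qed

lemma cut_02_2: "p * (w - y) \<le> x * w + w * w"
proof -
  have "p * (w - y) \<le> (x + w) * w"
    using box[of "x + w" w "w - y" 0 0] pos by simp
  then show ?thesis by (simp add: algebra_simps)
qed

lemma cut_12_2: "p * (w - x) \<le> y * w + w * w"
proof -
  have "p * (w - x) \<le> (y + w) * w"
    using box[of "y + w" w "w - x" 0 0] pos by simp
  then show ?thesis by (simp add: algebra_simps)
qed

lemma cut_2_2: "p * (w - x - y) \<le> w * w"
proof -
  have "p * (w - x - y) \<le> w * w"
    using box[of w w "w - x - y" 0 0] pos by simp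
  then show ?thesis by (simp add: algebra_simps)
qed

text \<open>
  The rows of the two smaller lengths fit into the diagonal blocks. If \<open>z = q * y\<close>,
  this is a box inequality for block 0; elsewhere bounds on the numbers of rows suffice.
\<close>

lemma K00_nonneg: "0 \<le> K00"
proof (cases rule: z_cases)
  case qx
  then show ?thesis using count_products(6) by (simp add: algebra_simps)
next
  case qy
  have "q * (x - y) + r * x \<le> x * x" using box[of x x 0 "x - y" x] pos by simp
  then show ?thesis using qy(1) by (simp add: algebra_simps)
next
  case xy
  then show ?thesis using count_products(4) by (simp add: algebra_simps)
qed

lemma K11_nonneg: "0 \<le> K11"
proof (cases rule: z_cases)
  case qx
  then show ?thesis using qx(2) products(4) by (simp add: algebra_simps)
next
  case qy
  then show ?thesis using products(5) by (simp add: algebra_simps)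
next
  case xy
  then show ?thesis using count_products(5) by (simp add: algebra_simps)
qed

text \<open>
  In the remaining conditions \<open>z\<close> occurs with coefficient 1, so that its large value is needed. If
  \<open>z\<close> is \<open>q * x\<close> or \<open>q * y\<close>, then the rows of length \<open>x + y\<close> have only the cells in the diagonal blocks
  that are forced, and the box of the cut gives the claim. If \<open>z = x * y\<close>, then \<open>K01 = 0\<close>,
  which makes the claim a consequence of the previous conditions.
\<close>

lemma cut_0_0: "p * (x - y - w) \<le> K00"
proof (cases rule: z_cases)
  case qx
  have "p * (x - y - w) + r * x \<le> x * x"
    using box[of x x "x - y - w" 0 x] pos by simp
  then show ?thesis using qx(1) by (simp add: algebra_simps)
next
  case qy
  have "p * (x - y - w) + q * (x - y) + r * x \<le> x * x"
    using box[of x x "x - y - w" "x - y" x] pos by simp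
  then show ?thesis using qy(1) by (simp add: algebra_simps)
next
  case xy
  then show ?thesis using products(2) cut_01_0 by (simp add: algebra_simps)
qed

lemma cut_02_0: "p * (x - y) \<le> K00 + x * w"
proof (cases rule: z_cases)
  case qx
  have "p * (x - y) + r * x \<le> x * (x + w)"
    using box[of x "x + w" "x - y" 0 x] pos by simp
  then show ?thesis using qx(1) by (simp add: algebra_simps)
next
  case qy
  have "p * (x - y) + q * (x - y) + r * x \<le> x * (x + w)"
    using box[of x "x + w" "x - y" "x - y" x] pos by simp
  then show ?thesis using qy(1) by (simp add: algebra_simps)
next
  case xy
  then show ?thesis using products(2) cut_012_0 by (simp add: algebra_simps)
qed

lemma cut_02_02: "p * (x + w - y) \<le> K00 + x * w + x * w + w * w"
proof (cases rule: z_cases)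
  case qx
  have "p * (x + w - y) + r * x \<le> (x + w) * (x + w)"
    using box[of "x + w" "x + w" "x + w - y" 0 x] pos by simp
  then show ?thesis using qx(1) by (simp add: algebra_simps)
next
  case qy
  have "p * (x + w - y) + q * (x - y) + r * x \<le> (x + w) * (x + w)"
    using box[of "x + w" "x + w" "x + w - y" "x - y" x] pos by simp
  then show ?thesis using qy(1) by (simp add: algebra_simps)
next
  case xy
  then show ?thesis using cut_012_0 cut_02_2 by (simp add: algebra_simps)
qed

lemma cut_1_1: "p * (y - x - w) \<le> K11"
proof (cases rule: z_cases)
  case qx
  have "p * (y - x - w) + q * (y - x) \<le> y * y"
    using box[of y y "y - x - w" "y - x" 0] pos by simp
  then show ?thesis using qx(1) by (simp add: algebra_simps)
next
  case qy
  have "p * (y - x - w) \<le> y * y"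
    using box[of y y "y - x - w" 0 0] pos by simp
  then show ?thesis using qy(1) by (simp add: algebra_simps)
next
  case xy
  then show ?thesis using products(1) cut_01_1 by (simp add: algebra_simps)
qed

lemma cut_12_1: "p * (y - x) \<le> K11 + y * w"
proof (cases rule: z_cases)
  case qx
  have "p * (y - x) + q * (y - x) \<le> y * (y + w)"
    using box[of y "y + w" "y - x" "y - x" 0] pos by simp
  then show ?thesis using qx(1) by (simp add: algebra_simps)
next
  case qy
  have "p * (y - x) \<le> y * (y + w)"
    using box[of y "y + w" "y - x" 0 0] pos by simp
  then show ?thesis using qy(1) by (simp add: algebra_simps)
next
  case xy
  then show ?thesis using products(1) cut_012_1 by (simp add: algebra_simps)
qed

lemma cut_12_12: "p * (y + w - x) \<le> K11 + y * w + y * w + w * w"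
proof (cases rule: z_cases)
  case qx
  have "p * (y + w - x) + q * (y - x) \<le> (y + w) * (y + w)"
    using box[of "y + w" "y + w" "y + w - x" "y - x" 0] pos by simp
  then show ?thesis using qx(1) by (simp add: algebra_simps)
next
  case qy
  have "p * (y + w - x) \<le> (y + w) * (y + w)"
    using box[of "y + w" "y + w" "y + w - x" 0 0] pos by simp
  then show ?thesis using qy(1) by (simp add: algebra_simps)
next
  case xy
  then show ?thesis using cut_012_1 cut_12_2 by (simp add: algebra_simps)
qed

lemma residual_values:
  "residual 0 0 = K00" "residual 0 (Suc 0) = K01" "residual (Suc 0) 0 = K01" "residual (Suc 0) (Suc 0) = K11"
  "residual 0 2 = x * w" "residual 2 0 = x * w" "residual (Suc 0) 2 = y * w" "residual 2 (Suc 0) = y * w"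
  "residual 2 2 = w * w"
  by (simp_all add: residual_def middle_def group_size_def)

lemma residual_nonneg: "0 \<le> residual u v" if "u \<in> {0, 1, 2}" "v \<in> {0, 1, 2}" for u v
  using that K00_nonneg K11_nonneg z_bounds(4) products by (elim insertE emptyE) (simp_all add: residual_values)

text \<open>
  The cut condition for \<open>U\<close> and \<open>V = {0, 1, 2} - W\<close>, for all 64 pairs. The pairs that have no named
  inequality follow by symmetry, by adding such inequalities and nonnegative capacities, or because
  \<open>U\<close> and \<open>V\<close> together are too small to force any cells.
\<close>

lemma residual_cut:
  assumes "U \<subseteq> {0, 1, 2}" "W \<subseteq> {0, 1, 2}"
  shows "(\<Sum>u\<in>U. p * group_size u) \<le> (\<Sum>v\<in>W. p * group_size v) + (\<Sum>u\<in>U. \<Sum>v\<in>{0, 1, 2} - W. residual u v)"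
proof -
  \<comment> \<open>Opaque names for the capacities make the goals linear in a few products.\<close>
  define k00 where "k00 = K00"
  define k01 where "k01 = K01"
  define k11 where "k11 = K11"
  have P: "group_size 0 = x" "group_size (Suc 0) = y" "group_size 2 = w" by (simp_all add: group_size_def)
  have k01: "k01 \<ge> 0" using z_bounds by (simp add: k01_def)
  note R = residual_values[folded k00_def k01_def k11_def]
  note expand = k00_def[symmetric] k01_def[symmetric] k11_def[symmetric] right_diff_distrib distrib_left
  note commute = mult.commute[of x w] mult.commute[of y w]
  have subsets: "X \<in> {{}, {0}, {1}, {2}, {0, 1}, {0, 2}, {1, 2}, {0, 1, 2}}"
    if "X \<subseteq> {0, 1, 2}" for X :: "nat set"
    using that unfolding Pow_iff[symmetric] Pow_insert Pow_empty by auto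
  have cut: "(\<Sum>u\<in>U. p * group_size u) + (\<Sum>v\<in>V. p * group_size v)
      \<le> p * x + p * y + p * w + (\<Sum>u\<in>U. \<Sum>v\<in>V. residual u v)"
    if V: "V \<subseteq> {0, 1, 2}" for V :: "nat set"
    using subsets[OF assms(1)]
  proof (elim insertE emptyE)
    assume "U = {}"
    then show ?thesis
      using subsets[OF V]
      by (elim insertE emptyE; simp add: P R; (insert products(1-3), linarith)?)
  next
    assume "U = {0}"
    then show ?thesis
      using subsets[OF V]
      by (elim insertE emptyE; simp add: P R;
          (insert products(1-3,6) k01 cut_0_0 cut_02_0 cut_01_0 cut_012_0,
            (unfold expand)?, (unfold commute)?, linarith)?)
  next
    assume "U = {1}"
    then show ?thesis
      using subsets[OF V]
      by (elim insertE emptyE; simp add: P R;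
          (insert products(1-3,7) k01 cut_1_1 cut_12_1 cut_01_1 cut_012_1,
            (unfold expand)?, (unfold commute)?, linarith)?)
  next
    assume "U = {2}"
    then show ?thesis
      using subsets[OF V]
      by (elim insertE emptyE; simp add: P R;
          (insert products(1-3,6-8) cut_2_2 cut_02_2 cut_12_2 cut_012_2,
            (unfold expand)?, (unfold commute)?, linarith)?)
  next
    assume "U = {0, 1}"
    then show ?thesis
      using subsets[OF V]
      by (elim insertE emptyE; simp add: P R;
          (insert products(1-3,6,7) cut_01_0 cut_01_1 cut_01_01 cut_01_02 cut_01_12 cut_012_0 cut_012_1,
            (unfold expand)?, (unfold commute)?, linarith)?)
  next
    assume "U = {0, 2}"
    then show ?thesis
      using subsets[OF V]
      by (elim insertE emptyE; simp add: P R;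
          (insert products(1-3,6-8) k01 cut_02_0 cut_02_2 cut_01_02 cut_02_02 cut_012_0 cut_012_2,
            (unfold expand)?, (unfold commute)?, linarith)?)
  next
    assume "U = {1, 2}"
    then show ?thesis
      using subsets[OF V]
      by (elim insertE emptyE; simp add: P R;
          (insert products(1-3,6-8) k01 cut_12_1 cut_12_2 cut_01_12 cut_12_12 cut_012_1 cut_012_2,
            (unfold expand)?, (unfold commute)?, linarith)?)
  next
    assume "U = {0, 1, 2}"
    then show ?thesis
      using subsets[OF V]
      by (elim insertE emptyE; simp add: P R;
          (insert products(1-3) cut_012_0 cut_012_1 cut_012_2,
            (unfold expand)?, (unfold commute)?, linarith)?)
  qed
  have "(\<Sum>v\<in>{0, 1, 2}. p * group_size v) = p * x + p * y + p * w" by (simp add: P)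
  then show ?thesis
    using cut[of "{0, 1, 2} - W"] sum.subset_diff[OF assms(2), of "\<lambda>v. p * group_size v"] by auto
qed

lemma middle_nonneg: "0 \<le> middle u v"
  using z_bounds by (simp add: middle_def)

lemma middle_sums: "middle u 0 + middle u (Suc 0) + middle u 2 = (if u < 2 then q * group_size u else 0)"
    "middle 0 v + middle (Suc 0) v + middle 2 v = (if v < 2 then q * group_size v else 0)"
  by (auto simp: middle_def group_size_def)

end

section \<open>Wide diagrams with three row lengths are Latin\<close>

theorem theorem3:
  fixes Y :: "nat multiset"
  assumes "young_diagram Y"
    and "card (set_mset Y) = 3"
    and "wide Y"
  shows "latin Y"
proof -
  obtain a b c where Y: "set_mset Y = {a, b, c}" and abc: "c < b" "b < a"
  proof -
    define xs where "xs = sorted_list_of_set (set_mset Y)"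
    have xs: "length xs = 3" "sorted_wrt (<) xs" "set xs = set_mset Y"
      using assms(2) by (simp_all add: xs_def)
    then obtain c b a where "xs = [c, b, a]" by (auto simp: numeral_3_eq_3 length_Suc_conv)
    then show thesis using that[of a b c] xs by auto
  qed
  have c: "0 < c" using assms(1) Y by (simp add: young_diagram_def)
  have ne: "a \<noteq> b" "a \<noteq> c" "b \<noteq> c" "b \<noteq> a" "c \<noteq> a" "c \<noteq> b" using abc by auto
  define p q r where "p = int (count Y a)" and "q = int (count Y b)" and "r = int (count Y c)"
  interpret three_lengths p q r "int c" "int b - int c" "int a - int b"
  proof
    fix m n :: int
    assume "0 \<le> m" "0 \<le> n"
    then obtain m' n' where mn: "m = int m'" "n = int n'" by (meson nonneg_int_cases)
    have sizes: "int c + (int b - int c) = int b" "int b + (int a - int b) = int a" by simp_all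
    have "p * forced (int a) m n + q * forced (int b) m n + r * forced (int c) m n \<le> m * n"
      using wide_forced[OF assms(3), of m' n'] ne
      by (simp add: Y p_def q_def r_def mn)
    then show "p * forced (int c + (int b - int c) + (int a - int b)) m n
        + q * forced (int c + (int b - int c)) m n + r * forced (int c) m n \<le> m * n"
      by (simp only: sizes)
  qed (use abc c in \<open>simp_all add: p_def q_def r_def\<close>)
  define N where "N = (\<lambda>u. nat (group_size u))"
  have N: "int (N u) = group_size u" for u using pos by (simp add: N_def group_size_def)
  let ?G = "{0, 1, 2} :: nat set"
  define res where "res = (\<lambda>u v. nat (residual u v))"
  have res: "int (res u v) = residual u v" if "u \<in> ?G" "v \<in> ?G" for u v
    using residual_nonneg that by (simp add: res_def)
  \<comment> \<open>The supplies and demands are the margins of the longest rows, so \<open>A\<close> is a table of block counts.\<close>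
  have "\<exists>A. (\<forall>u\<in>?G. \<forall>v\<in>?G. A u v \<le> res u v) \<and> (\<forall>u\<in>?G. (\<Sum>v\<in>?G. A u v) = count Y a * N u)
    \<and> (\<forall>v\<in>?G. (\<Sum>u\<in>?G. A u v) = count Y a * N v)"
  proof (rule transportation)
    fix U W assume UW: "U \<subseteq> ?G" "W \<subseteq> ?G"
    have "int (\<Sum>u\<in>U. count Y a * N u) \<le> int (cut_bound res (\<lambda>v. count Y a * N v) ?G U W)"
    proof -
      have "(\<Sum>u\<in>U. \<Sum>v\<in>?G - W. int (res u v)) = (\<Sum>u\<in>U. \<Sum>v\<in>?G - W. residual u v)"
        using UW by (intro sum.cong refl res) auto
      then show ?thesis
        using residual_cut[OF UW] by (simp add: cut_bound_def N p_def)
    qed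
    then show "(\<Sum>u\<in>U. count Y a * N u) \<le> cut_bound res (\<lambda>v. count Y a * N v) ?G U W"
      by (simp only: of_nat_le_iff)
  qed simp_all
  then obtain A where A: "\<And>u v. u \<in> ?G \<Longrightarrow> v \<in> ?G \<Longrightarrow> A u v \<le> res u v"
    "\<And>u. u \<in> ?G \<Longrightarrow> (\<Sum>v\<in>?G. A u v) = count Y a * N u"
    "\<And>v. v \<in> ?G \<Longrightarrow> (\<Sum>u\<in>?G. A u v) = count Y a * N v" by blast
  \<comment> \<open>Group \<open>u\<close> of the columns begins at \<open>start u\<close>, so that rows of length \<open>l\<close> meet it iff \<open>start u < l\<close>.\<close>
  define g :: "nat \<Rightarrow> nat" where "g j = (if j < c then 0 else if j < b then 1 else 2)" for j
  define start :: "nat \<Rightarrow> nat" where "start u = (if u = 0 then 0 else if u = 1 then c else b)" for u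
  define m where "m l u = (if start u < l then count Y l else 0)" for l u
  define X where "X l u v = (if l = a then A u v else if l = b then nat (middle u v)
      else if u = 0 \<and> v = 0 then count Y c * c else 0)" for l u v
  have card: "card {j \<in> {..<a}. g j = u} = N u" if "u \<in> ?G" for u
  proof -
    have "{j \<in> {..<a}. g j = 0} = {..<c}" "{j \<in> {..<a}. g j = 1} = {c..<b}" "{j \<in> {..<a}. g j = 2} = {b..<a}"
      using abc by (auto simp: g_def)
    note parts = this
    have "int (N 0) = int c" "int (N 1) = int b - int c" "int (N 2) = int a - int b"
      by (simp_all only: N) (simp_all add: group_size_def)
    then have "N 0 = c" "N 1 = b - c" "N 2 = a - b" by linarith+
    then show ?thesis using that
      by (elim insertE emptyE) (simp_all only: parts card_lessThan card_atLeastLessThan)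
  qed
  have "\<exists>f :: nat \<Rightarrow> nat \<Rightarrow> nat \<Rightarrow> nat.
     (\<forall>j\<in>{..<a}. \<forall>k\<in>{..<a}. (\<Sum>l\<in>set_mset Y. f j k l) \<le> 1) \<and>
     (\<forall>l\<in>set_mset Y. \<forall>j\<in>{..<a}. (\<Sum>k\<in>{..<a}. f j k l) = m l (g j)) \<and>
     (\<forall>l\<in>set_mset Y. \<forall>k\<in>{..<a}. (\<Sum>j\<in>{..<a}. f j k l) = m l (g k))"
  proof (rule partial_outline_disentangle[where G = ?G and x = X])
    show "g ` {..<a} \<subseteq> ?G" by (auto simp: g_def)
    have mids: "int (\<Sum>v\<in>?G. nat (middle u v)) = int (if u < 2 then count Y b * N u else 0)"
      "int (\<Sum>v\<in>?G. nat (middle v u)) = int (if u < 2 then count Y b * N u else 0)" for u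
      using middle_sums[of u] by (simp_all add: middle_nonneg N add.assoc flip: q_def)
    note mids = mids[unfolded of_nat_eq_iff]
    have low: "(\<Sum>v\<in>?G. if u = 0 \<and> v = 0 then count Y c * c else 0) = N u * (if u = 0 then count Y c else 0)"
      "(\<Sum>v\<in>?G. if v = 0 \<and> u = 0 then count Y c * c else 0) = N u * (if u = 0 then count Y c else 0)" for u
      by (auto simp: N_def group_size_def)
    fix l u assume l: "l \<in> set_mset Y" and u: "u \<in> ?G"
    have m: "m a u = count Y a" "m b u = (if u < 2 then count Y b else 0)" "m c u = (if u = 0 then count Y c else 0)"
      using u abc c by (auto simp: m_def start_def)
    have Xv: "X a u v = A u v" "X b u v = nat (middle u v)"
      "X c u v = (if u = 0 \<and> v = 0 then count Y c * c else 0)" for u v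
      using ne by (simp_all add: X_def)
    consider "l = a" | "l = b" | "l = c" using l Y by auto
    note l' = this
    show "(\<Sum>v\<in>?G. X l u v) = card {j \<in> {..<a}. g j = u} * m l u"
      unfolding card[OF u] using l' by cases (simp_all only: Xv A(2)[OF u] mids low m, simp_all)
    show "(\<Sum>v\<in>?G. X l v u) = card {j \<in> {..<a}. g j = u} * m l u"
      unfolding card[OF u] using l' by cases (simp_all only: Xv A(3)[OF u] mids low m, simp_all)
  next
    fix u v assume uv: "u \<in> ?G" "v \<in> ?G"
    have "int (\<Sum>l\<in>set_mset Y. X l u v)
        = int (A u v) + middle u v + (if u = 0 \<and> v = 0 then int (count Y c * c) else 0)"
      using ne by (simp add: Y X_def middle_nonneg)
    also have "\<dots> \<le> residual u v + middle u v + (if u = 0 \<and> v = 0 then r * int c else 0)"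
    proof -
      have "int (A u v) \<le> residual u v" using A(1)[OF uv] res[OF uv] by linarith
      moreover have "int (count Y c * c) = r * int c" by (simp add: r_def)
      ultimately show ?thesis by (simp only: add_mono order_refl)
    qed
    also have "\<dots> = int (N u * N v)" by (simp add: residual_def N)
    finally show "(\<Sum>l\<in>set_mset Y. X l u v) \<le> card {j \<in> {..<a}. g j = u} * card {j \<in> {..<a}. g j = v}"
      unfolding card[OF uv(1)] card[OF uv(2)] by (simp only: of_nat_le_iff)
  qed simp_all
  then obtain f where f1: "\<forall>j\<in>{..<a}. \<forall>k\<in>{..<a}. (\<Sum>l\<in>set_mset Y. f j k l) \<le> (1::nat)"
    and "\<forall>l\<in>set_mset Y. \<forall>j\<in>{..<a}. (\<Sum>k\<in>{..<a}. f j k l) = m l (g j)"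
    and "\<forall>l\<in>set_mset Y. \<forall>k\<in>{..<a}. (\<Sum>j\<in>{..<a}. f j k l) = m l (g k)"
    by (elim exE conjE)
  note f = this(2,3)
  have f2: "(\<Sum>k<a. f j k l) = m l (g j)" if "l \<in># Y" "j < a" for l j
    using that by (intro f(1)[rule_format]) simp_all
  have f3: "(\<Sum>j<a. f j k l) = m l (g k)" if "l \<in># Y" "k < a" for l k
    using that by (intro f(2)[rule_format]) simp_all
  have mg: "m l (g j) = (if j < l then count Y l else 0)" if "l \<in># Y" "j < a" for l j
    using that abc c unfolding Y m_def g_def start_def by auto
  have le: "l \<le> a" if "l \<in># Y" for l using that abc Y by auto
  \<comment> \<open>Degree 0 outside the columns and symbols below \<open>l\<close> confines the graph of \<open>l\<close> to them.\<close>
  have zero: "f j k l = 0" if "l \<in># Y" "j < a" "k < a" "l \<le> j \<or> l \<le> k" for j k l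
    using that(4)
  proof
    assume "l \<le> j"
    then have "(\<Sum>k<a. f j k l) = 0" using f2[OF that(1,2)] by (simp add: mg that(1-3))
    then show ?thesis using that(3) by simp
  next
    assume "l \<le> k"
    then have "(\<Sum>j<a. f j k l) = 0" using f3[OF that(1,3)] by (simp add: mg that(1-3))
    then show ?thesis using that(2) by simp
  qed
  show ?thesis
  proof (rule latin_if_regular_packing)
    fix l j assume l: "l \<in># Y" and j: "j < l"
    have ja: "j < a" using j le[OF l] by simp
    have "(\<Sum>k<l. f j k l) = (\<Sum>k<a. f j k l)"
      using le[OF l] ja by (intro sum.mono_neutral_left) (auto intro!: zero[OF l])
    then show "(\<Sum>k<l. f j k l) = count Y l"
      using f2[OF l ja] j by (simp add: mg[OF l ja])
    have "(\<Sum>k<l. f k j l) = (\<Sum>k<a. f k j l)"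
      using le[OF l] ja by (intro sum.mono_neutral_left) (auto intro!: zero[OF l])
    then show "(\<Sum>k<l. f k j l) = count Y l"
      using f3[OF l ja] j by (simp add: mg[OF l ja])
  next
    fix l j k assume "l \<in># Y" "j < l" "k < l"
    then show "(\<Sum>l\<in>set_mset Y. f j k l) \<le> 1"
      using le[of l] by (intro f1[rule_format]) simp_all
  qed
qed

end
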